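(* Let $p$ be a prime and $\alpha,\beta,\gamma,\lambda$ positive integers such that $w=\alpha+\beta+\gamma+\lambda$ is odd and $p>w+2$. Put $n=\alpha+\beta+\gamma$. Then $$Z_p(\alpha,\beta,\gamma,\lambda)\equiv(-1)^\lambda\Bigg(\sum_{a=1}^{\alpha}\sum_{b=1}^{\beta}\binom{n-a-b-1}{\alpha-a,\beta-b,\gamma-1}t_p(a,b;w-a-b)+\sum_{a=1}^{\alpha}\sum_{c=1}^{\gamma}\binom{n-a-c-1}{\alpha-a,\gamma-c,\beta-1}t_p(a,c;w-a-c)$$ $$+\sum_{b=1}^{\beta}\sum_{c=1}^{\gamma}\binom{n-b-c-1}{\beta-b,\gamma-c,\alpha-1}t_p(b,c;w-b-c)\Bigg)B_{p-w}\pmod p,$$ where for positive integers $x,y,z$ $$t_p(x,y;z)=\sum_{s=0}^{x-1}\binom{s+y-1}{s}h_p(x-s,y+s,z)+\sum_{t=0}^{y-1}\binom{t+x-1}{t}h_p(y-t,x+t,z),$$ and for positive integers $x,y,z$ with $m=x+y+z$, $$h_p(x,y,z)=\frac{1}{2m}\left((-1)^{x}\binom{m}{x}-(-1)^{z}\binom{m}{z}\right).$$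
   Context: Let $\mathcal{P}_p$ be the set of positive integers not divisible by $p$. For positive integers $s_1,\dots,s_d$, $Z_p(s_1,\dots,s_d)=\sum_{k_1+\cdots+k_d=p,\ k_i\in\mathcal{P}_p}\frac{1}{k_1^{s_1}\cdots k_d^{s_d}}$. $B_j$ denotes the $j$-th Bernoulli number, and $\binom{N}{i,j,k}=\frac{N!}{i!\,j!\,k!}$ for $i+j+k=N$ is the multinomial coefficient. Congruences are in the ring of $p$-integral rationals. *)

theory Defs
  imports "HOL-Computational_Algebra.Computational_Algebra"
begin

definition p_integral :: "nat \<Rightarrow> rat set" where
  "p_integral p = {of_int a / of_int b | a b. \<not> int p dvd b}"

text \<open>Congruence in the ring of \<open>p\<close>-integral rationals; both sides are required to lie in the ring.\<close>

definition rat_cong :: "nat \<Rightarrow> rat \<Rightarrow> rat \<Rightarrow> bool" where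
  "rat_cong p x y \<longleftrightarrow>
     x \<in> p_integral p \<and> y \<in> p_integral p \<and> (\<exists>z\<in>p_integral p. x - y = of_nat p * z)"

definition prime_to_p :: "nat \<Rightarrow> nat set" where
  "prime_to_p p = {k. k > 0 \<and> \<not> p dvd k}"

definition Zp :: "nat \<Rightarrow> nat list \<Rightarrow> rat" where
  "Zp p ss =
     (\<Sum>ks | length ks = length ss \<and> sum_list ks = p \<and> set ks \<subseteq> prime_to_p p.
        1 / (\<Prod>i<length ss. of_nat (ks ! i) ^ (ss ! i)))"

fun bernoulli :: "nat \<Rightarrow> rat" where
  "bernoulli 0 = 1"
| "bernoulli (Suc n) = - (\<Sum>k\<le>n. of_nat (n + 2 choose k) * bernoulli k) / of_nat (n + 2)"

declare bernoulli.simps [simp del]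

lemma sum_binomial_bernoulli:
  "(\<Sum>k\<le>n. of_nat (Suc n choose k) * bernoulli k) = (if n = 0 then 1 else 0)"
proof (cases n)
  case 0
  then show ?thesis by (simp add: bernoulli.simps)
next
  case (Suc m)
  have "of_nat (m + 2) * bernoulli (Suc m) = - (\<Sum>k\<le>m. of_nat (m + 2 choose k) * bernoulli k)"
    by (simp add: bernoulli.simps del: of_nat_add of_nat_Suc)
  moreover have "(m + 2 choose Suc m) = m + 2"
    using binomial_symmetric[of "Suc m" "m + 2"] by simp
  ultimately show ?thesis
    using Suc by simp
qed

lemma bernoulli_generating_function:
  "Abs_fps (\<lambda>n. bernoulli n / fact n) * (fps_exp 1 - 1) = fps_X"
proof (rule fps_ext)
  fix n :: nat
  show "fps_nth (Abs_fps (\<lambda>n. bernoulli n / fact n) * (fps_exp 1 - 1)) n = fps_nth fps_X n"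
  proof (cases n)
    case 0
    then show ?thesis by (simp add: fps_mult_nth)
  next
    case (Suc m)
    have "fps_nth (Abs_fps (\<lambda>n. bernoulli n / fact n) * (fps_exp 1 - 1)) n =
        (\<Sum>k\<le>m. bernoulli k / fact k * (1 / fact (Suc m - k)))"
      by (auto simp: fps_mult_nth Suc atLeast0AtMost intro!: sum.cong)
    also have "\<dots> = (\<Sum>k\<le>m. of_nat (Suc m choose k) * bernoulli k) / fact (Suc m)"
      unfolding sum_divide_distrib
      by (intro sum.cong refl) (simp add: binomial_fact field_simps del: fact_Suc)
    also have "\<dots> = fps_nth fps_X n"
      by (simp add: sum_binomial_bernoulli Suc)
    finally show ?thesis .
  qed
qed

definition multinomial3 :: "nat \<Rightarrow> nat \<Rightarrow> nat \<Rightarrow> nat \<Rightarrow> rat" where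
  "multinomial3 N i j k = fact N / (fact i * fact j * fact k)"

text \<open>Neither of the following two quantities depends on \<open>p\<close>.\<close>

definition h_coeff :: "nat \<Rightarrow> nat \<Rightarrow> nat \<Rightarrow> rat" where
  "h_coeff x y z = (let m = x + y + z in
     1 / (2 * of_nat m) * ((-1) ^ x * of_nat (m choose x) - (-1) ^ z * of_nat (m choose z)))"

definition t_coeff :: "nat \<Rightarrow> nat \<Rightarrow> nat \<Rightarrow> rat" where
  "t_coeff x y z =
     (\<Sum>s=0..x-1. of_nat (s + y - 1 choose s) * h_coeff (x - s) (y + s) z) +
     (\<Sum>r=0..y-1. of_nat (r + x - 1 choose r) * h_coeff (y - r) (x + r) z)"

end

theory Submission
  imports Defs "HOL-Number_Theory.Residues"
begin

text \<open>
  In a composition \<open>x + y + z + k = p\<close> one has \<open>k \<equiv> -N\<close> with \<open>N = x + y + z\<close>. Partial fractions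
  expand \<open>1/(x^\<alpha> y^\<beta> z^\<gamma>)\<close> into terms containing only two of the variables and \<open>N\<close>; a second
  expansion, with \<open>M = x + y\<close>, reduces these to sums over \<open>0 < x < M < N < p\<close>, that is, to triple
  harmonic sums of odd weight \<open>w\<close>. Inclusion-exclusion expresses such a sum modulo \<open>p\<close> by its
  reversal and double sums; the reversal \<open>i \<mapsto> p - i\<close> contributes the sign \<open>(-1)^w = -1\<close>, so twice
  the triple sum is a combination of double sums. Double sums follow from Fermat's theorem and
  Faulhaber's formula: only one Bernoulli number survives summation over the outer index.
\<close>

section \<open>Partial fractions\<close>

text \<open>Pascal's rule yields terms whose index is lowered by one, encoded as a
  \<open>case\<close> with value 0 at index 0. Undoing the shift shortens the range by one, which
  matches the lowered exponent in the recursions below.\<close>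

lemma sum_lessThan_shift_zero:
  fixes f :: "nat \<Rightarrow> 'a::comm_monoid_add"
  shows "(\<Sum>i<Suc n. case i of 0 \<Rightarrow> 0 | Suc i' \<Rightarrow> f i') = (\<Sum>i<n. f i)"
  by (simp only: sum.lessThan_Suc_shift) simp

text \<open>With \<open>X\<close> = 1/x and \<open>V\<close> = 1/(x+y), this is the part of the
  expansion of 1/(x^a y^b) in which y occurs only through x+y. For \<open>b = 0\<close> truncated
  subtraction leaves only the term \<open>i = 0\<close>.\<close>

definition pf2 :: "'a::comm_ring_1 \<Rightarrow> 'a \<Rightarrow> nat \<Rightarrow> nat \<Rightarrow> 'a" where
  "pf2 V X a b = (\<Sum>i<a. of_nat (i + b - 1 choose i) * (X ^ (a - i) * V ^ (b + i)))"

text \<open>Pascal's rule on the coefficients: the part with lowered index belongs to the lowered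
  first exponent, the rest to the lowered second one.\<close>

lemma pf2_Suc_Suc:
  "pf2 V X (Suc a) (Suc b) = V * (pf2 V X a (Suc b) + pf2 V X (Suc a) b)"
proof -
  have coeff: "of_nat (i + Suc b - 1 choose i) * (X ^ (Suc a - i) * V ^ (Suc b + i)) =
      V * ((case i of 0 \<Rightarrow> 0 | Suc i' \<Rightarrow> of_nat (i' + Suc b - 1 choose i') * (X ^ (a - i') * V ^ (Suc b + i')))
        + of_nat (i + b - 1 choose i) * (X ^ (Suc a - i) * V ^ (b + i)))" for i
    by (cases i) (simp_all add: algebra_simps)
  show ?thesis
    unfolding pf2_def coeff sum_distrib_left [symmetric] sum.distrib sum_lessThan_shift_zero by simp
qed

lemma pf2_zero: "pf2 V X (Suc a) 0 = X ^ Suc a"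
proof -
  have "of_nat (i + 0 - 1 choose i) * (X ^ (Suc a - i) * V ^ (0 + i)) = (if i = 0 then X ^ Suc a else 0)" for i
    by (cases i) (auto simp: binomial_eq_0)
  then show ?thesis by (simp add: pf2_def)
qed

text \<open>The relation \<open>XY\<close> is 1/(xy) = (1/(x+y)) (1/x + 1/y). Each use of it lowers
  one exponent, and the right-hand side obeys the same recursion by \<open>pf2_Suc_Suc\<close>. At a
  = b = 0 both expansions are empty sums, whereas the left-hand side is 1.\<close>

lemma partial_fractions2:
  fixes X Y V :: "'a::comm_ring_1"
  assumes XY: "X * Y = V * (X + Y)" and "a + b > 0"
  shows "X ^ a * Y ^ b = pf2 V X a b + pf2 V Y b a"
  using \<open>a + b > 0\<close>
proof (induction "a + b" arbitrary: a b rule: less_induct)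
  case less
  show ?case
  proof (cases "a = 0 \<or> b = 0")
    case True
    with less.prems show ?thesis
      by (cases a; cases b) (auto simp: pf2_zero, auto simp: pf2_def)
  next
    case False
    then obtain a' b' where ab: "a = Suc a'" "b = Suc b'"
      by (metis not0_implies_Suc)
    have "X ^ a * Y ^ b = X ^ a' * Y ^ b' * (X * Y)"
      by (simp add: ab algebra_simps)
    also have "\<dots> = V * (X ^ a' * Y ^ b + X ^ a * Y ^ b')"
      unfolding XY by (simp add: ab algebra_simps)
    also have "\<dots> = V * ((pf2 V X a' b + pf2 V Y b a') + (pf2 V X a b' + pf2 V Y b' a))"
      using less.hyps[of a' b] less.hyps[of a b'] by (simp add: ab)
    also have "\<dots> = pf2 V X a b + pf2 V Y b a"
      by (simp add: ab pf2_Suc_Suc algebra_simps)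
    finally show ?thesis .
  qed
qed

text \<open>The trinomial coefficient \<open>(i+j+g-1)!/(i! j! (g-1)!)\<close>, written so that \<open>g = 0\<close> gives the
  Kronecker delta of \<open>i + j = 0\<close>; truncated subtraction makes Pascal's rule hold down to that case.\<close>

definition pf3_coeff :: "nat \<Rightarrow> nat \<Rightarrow> nat \<Rightarrow> nat" where
  "pf3_coeff i j g = (i + j + g - 1 choose (i + j)) * (i + j choose i)"

lemma pf3_coeff_zero: "pf3_coeff i j 0 = (if i = 0 \<and> j = 0 then 1 else 0)"
  by (cases i; cases j) (auto simp: pf3_coeff_def)

lemma pf3_coeff_Suc:
  "pf3_coeff i j (Suc g) =
     (case i of 0 \<Rightarrow> 0 | Suc i' \<Rightarrow> pf3_coeff i' j (Suc g)) +
     (case j of 0 \<Rightarrow> 0 | Suc j' \<Rightarrow> pf3_coeff i j' (Suc g)) + pf3_coeff i j g"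
  by (cases i; cases j) (simp_all add: pf3_coeff_def algebra_simps)

text \<open>Links the expansion to the coefficients of the theorem and shows that these are natural
  numbers, hence \<open>p\<close>-integral.\<close>

lemma multinomial3_eq_pf3_coeff:
  assumes "g > 0"
  shows "multinomial3 (i + j + g - 1) i j (g - 1) = of_nat (pf3_coeff i j g)"
proof -
  obtain g' where "g = Suc g'" using assms gr0_conv_Suc by blast
  then show ?thesis
    by (simp add: multinomial3_def pf3_coeff_def binomial_fact)
qed

text \<open>The part of the three-variable expansion in which the variable with exponent
  \<open>c\<close> survives only through \<open>V\<close>, the reciprocal of the total.\<close>

definition pf3 :: "'a::comm_ring_1 \<Rightarrow> 'a \<Rightarrow> 'a \<Rightarrow> nat \<Rightarrow> nat \<Rightarrow> nat \<Rightarrow> 'a" where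
  "pf3 V X Y a b c =
     (\<Sum>i<a. \<Sum>j<b. of_nat (pf3_coeff i j c) * (X ^ (a - i) * Y ^ (b - j) * V ^ (i + j + c)))"

lemma pf3_Suc_Suc_Suc:
  "pf3 V X Y (Suc a) (Suc b) (Suc c) =
     V * (pf3 V X Y a (Suc b) (Suc c) + pf3 V X Y (Suc a) b (Suc c) + pf3 V X Y (Suc a) (Suc b) c)"
proof -
  define f where "f a b c i j = of_nat (pf3_coeff i j c) * (X ^ (a - i) * Y ^ (b - j) * V ^ (i + j + c))"
    for a b c i j
  have coeff: "f (Suc a) (Suc b) (Suc c) i j =
      V * ((case i of 0 \<Rightarrow> 0 | Suc i' \<Rightarrow> f a (Suc b) (Suc c) i' j)
         + (case j of 0 \<Rightarrow> 0 | Suc j' \<Rightarrow> f (Suc a) b (Suc c) i j')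
         + f (Suc a) (Suc b) c i j)" for i j
    unfolding f_def pf3_coeff_Suc[of i j c]
    by (cases i; cases j) (simp_all add: algebra_simps)
  \<comment> \<open>Pulls the case distinction on \<open>i\<close> out of the inner sum, so that
    \<open>sum_lessThan_shift_zero\<close> applies to the outer one.\<close>
  have "(\<Sum>i<Suc a. \<Sum>j<Suc b. case i of 0 \<Rightarrow> 0 | Suc i' \<Rightarrow> f a (Suc b) (Suc c) i' j)
      = (\<Sum>i<Suc a. case i of 0 \<Rightarrow> 0 | Suc i' \<Rightarrow> \<Sum>j<Suc b. f a (Suc b) (Suc c) i' j)"
    by (intro sum.cong refl) (simp split: nat.split)
  then show ?thesis
    unfolding pf3_def f_def [symmetric] coeff sum_distrib_left [symmetric] sum.distrib
    by (simp only: sum_lessThan_shift_zero)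
qed

lemma pf3_zero: "pf3 V X Y (Suc a) (Suc b) 0 = X ^ Suc a * Y ^ Suc b"
proof -
  have "of_nat (pf3_coeff i j 0) * (X ^ (Suc a - i) * Y ^ (Suc b - j) * V ^ (i + j + 0))
      = (if i = 0 then if j = 0 then X ^ Suc a * Y ^ Suc b else 0 else 0)" for i j
    by (simp add: pf3_coeff_zero)
  moreover have "(\<Sum>j<Suc b. if i = 0 then if j = 0 then X ^ Suc a * Y ^ Suc b else 0 else 0)
      = (if i = 0 then X ^ Suc a * Y ^ Suc b else 0)" for i :: nat
    by simp
  ultimately show ?thesis by (simp only: pf3_def) simp
qed

lemma pf3_zero_left: "pf3 V X Y 0 b c = 0" "pf3 V X Y a 0 c = 0"
  by (simp_all add: pf3_def)

text \<open>For reciprocals, \<open>XYZ\<close> says that \<open>V\<close> is the reciprocal of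
  x+y+z. Each use lowers one of three exponents. The recursion stops when one exponent reaches 0;
  the other two are then positive, and exactly one of the three expansions is nonzero, namely the
  product itself by \<open>pf3_zero\<close>.\<close>

lemma partial_fractions3:
  fixes X Y Z V :: "'a::comm_ring_1"
  assumes XYZ: "X * Y * Z = V * (Y * Z + X * Z + X * Y)"
    and "a + b > 0" "a + c > 0" "b + c > 0"
  shows "X ^ a * Y ^ b * Z ^ c = pf3 V X Y a b c + pf3 V X Z a c b + pf3 V Y Z b c a"
  using assms(2-)
proof (induction "a + b + c" arbitrary: a b c rule: less_induct)
  case less
  show ?case
  proof (cases "a = 0 \<or> b = 0 \<or> c = 0")
    case True
    with less.prems show ?thesis
      by (cases a; cases b; cases c) (auto simp: pf3_zero pf3_zero_left)
  next
    case False
    then obtain a' b' c' where abc: "a = Suc a'" "b = Suc b'" "c = Suc c'"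
      by (metis not0_implies_Suc)
    have "X ^ a * Y ^ b * Z ^ c = X ^ a' * Y ^ b' * Z ^ c' * (X * Y * Z)"
      by (simp add: abc algebra_simps)
    also have "\<dots> = V * (X ^ a' * Y ^ b * Z ^ c + X ^ a * Y ^ b' * Z ^ c + X ^ a * Y ^ b * Z ^ c')"
      unfolding XYZ by (simp add: abc algebra_simps)
    also have "\<dots> = V * ((pf3 V X Y a' b c + pf3 V X Z a' c b + pf3 V Y Z b c a')
        + (pf3 V X Y a b' c + pf3 V X Z a c b' + pf3 V Y Z b' c a)
        + (pf3 V X Y a b c' + pf3 V X Z a c' b + pf3 V Y Z b c' a))"
      using less.hyps[of a' b c] less.hyps[of a b' c] less.hyps[of a b c'] by (simp add: abc)
    also have "\<dots> = pf3 V X Y a b c + pf3 V X Z a c b + pf3 V Y Z b c a"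
      by (simp add: abc pf3_Suc_Suc_Suc algebra_simps)
    finally show ?thesis .
  qed
qed

section \<open>Faulhaber's formula\<close>

text \<open>Induction on \<open>j\<close>: the binomial theorem expands the increment of the
  right-hand side, and the coefficient of j^l contains the Bernoulli recursion of order r - l, which
  vanishes unless l = r. The range \<open>i < j\<close> fits the convention B_1 = -1/2.\<close>

lemma bernoulli_power_sum:
  "of_nat (Suc r) * (\<Sum>i<j. of_nat i ^ r) =
     (\<Sum>k\<le>r. of_nat (Suc r choose k) * bernoulli k * of_nat j ^ (Suc r - k))"
proof (induction j)
  case 0
  then show ?case by (simp add: Suc_diff_le)
next
  case (Suc j)
  have binom: "(of_nat (Suc j) :: rat) ^ (Suc r - k) =
      of_nat j ^ (Suc r - k) + (\<Sum>l\<le>r - k. of_nat (Suc r - k choose l) * of_nat j ^ l)"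
    if "k \<le> r" for k
  proof -
    have "(of_nat (Suc j) :: rat) ^ (Suc r - k) = (of_nat j + 1) ^ Suc (r - k)"
      using that by (simp add: Suc_diff_le add.commute)
    also have "\<dots> = (\<Sum>l\<le>Suc (r - k). of_nat (Suc (r - k) choose l) * of_nat j ^ l)"
      by (subst binomial_ring) simp
    finally show ?thesis using that by (simp add: Suc_diff_le)
  qed
  have "(\<Sum>k\<le>r. of_nat (Suc r choose k) * bernoulli k * of_nat (Suc j) ^ (Suc r - k)) =
      (\<Sum>k\<le>r. of_nat (Suc r choose k) * bernoulli k * of_nat j ^ (Suc r - k)) +
      (\<Sum>k\<le>r. \<Sum>l\<le>r - k. of_nat (Suc r choose k) * bernoulli k * (of_nat (Suc r - k choose l) * of_nat j ^ l))"
    unfolding sum.distrib [symmetric]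
    by (intro sum.cong refl) (simp only: binom atMost_iff distrib_left sum_distrib_left)
  \<comment> \<open>Both double sums run over the pairs with k + l \<le> r; only the order
    changes.\<close>
  also have "(\<Sum>k\<le>r. \<Sum>l\<le>r - k. of_nat (Suc r choose k) * bernoulli k * (of_nat (Suc r - k choose l) * of_nat j ^ l))
      = (\<Sum>l\<le>r. \<Sum>k\<le>r - l. of_nat (Suc r choose k) * bernoulli k * (of_nat (Suc r - k choose l) * of_nat j ^ l))"
    unfolding sum.Sigma[OF finite_atMost ballI[OF finite_atMost]]
    by (rule sum.reindex_bij_witness[of _ "\<lambda>(k, l). (l, k)" "\<lambda>(k, l). (l, k)"]) auto
  also have "\<dots> = (\<Sum>l\<le>r. of_nat (Suc r choose l) * of_nat j ^ l *
      (\<Sum>k\<le>r - l. of_nat (Suc (r - l) choose k) * bernoulli k))"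
  proof (intro sum.cong refl, unfold sum_distrib_left, intro sum.cong refl)
    fix l k assume lk: "l \<in> {..r}" "k \<in> {..r - l}"
    \<comment> \<open>Both products equal (r+1)!/(k! l! (r+1-k-l)!).\<close>
    have "of_nat (Suc r choose k) * (of_nat (Suc r - k choose l) :: rat) =
        of_nat (Suc r choose l) * of_nat (Suc (r - l) choose k)"
      using lk by (simp add: binomial_fact Suc_diff_le del: fact_Suc) (simp add: add.commute)
    then show "of_nat (Suc r choose k) * bernoulli k * (of_nat (Suc r - k choose l) * of_nat j ^ l) =
        of_nat (Suc r choose l) * of_nat j ^ l * (of_nat (Suc (r - l) choose k) * bernoulli k)"
      by (metis (no_types, lifting) mult.assoc mult.commute)
  qed
  also have "\<dots> = (\<Sum>l\<le>r. if l = r then of_nat (Suc r) * of_nat j ^ r else 0)"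
    unfolding sum_binomial_bernoulli by (intro sum.cong refl) auto
  also have "\<dots> = of_nat (Suc r) * of_nat j ^ r"
    by simp
  finally show ?case
    using Suc.IH by (simp add: algebra_simps)
qed

section \<open>Congruences between \<open>p\<close>-integral rationals\<close>

lemma p_integral_of_int: "prime p \<Longrightarrow> of_int a \<in> p_integral p"
  unfolding p_integral_def using prime_gt_1_nat[of p]
  by (intro CollectI exI[of _ a] exI[of _ 1]) auto

lemma p_integral_of_nat: "prime p \<Longrightarrow> of_nat a \<in> p_integral p"
  using p_integral_of_int[of p "int a"] by simp

context
  fixes p :: nat
  assumes p: "prime p"
begin

lemma p_integral_add:
  assumes "x \<in> p_integral p" "y \<in> p_integral p"
  shows "x + y \<in> p_integral p"
proof -
  from assms obtain a b c d where
    *: "x = of_int a / of_int b" "\<not> int p dvd b" "y = of_int c / of_int d" "\<not> int p dvd d"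
    by (auto simp: p_integral_def)
  then have "b \<noteq> 0" "d \<noteq> 0" by auto
  then have "x + y = of_int (a * d + c * b) / of_int (b * d)"
    using * by (simp add: field_simps)
  moreover have "\<not> int p dvd b * d"
    using * p by (simp add: prime_dvd_mult_iff)
  ultimately show ?thesis unfolding p_integral_def by blast
qed

lemma p_integral_mult:
  assumes "x \<in> p_integral p" "y \<in> p_integral p"
  shows "x * y \<in> p_integral p"
proof -
  from assms obtain a b c d where
    *: "x = of_int a / of_int b" "\<not> int p dvd b" "y = of_int c / of_int d" "\<not> int p dvd d"
    by (auto simp: p_integral_def)
  then have "x * y = of_int (a * c) / of_int (b * d)"
    by simp
  moreover have "\<not> int p dvd b * d"
    using * p by (simp add: prime_dvd_mult_iff)
  ultimately show ?thesis unfolding p_integral_def by blast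
qed

lemma p_integral_minus: "x \<in> p_integral p \<Longrightarrow> - x \<in> p_integral p"
  using p_integral_mult[OF p_integral_of_int[OF p, of "-1"]] by simp

lemma p_integral_diff: "x \<in> p_integral p \<Longrightarrow> y \<in> p_integral p \<Longrightarrow> x - y \<in> p_integral p"
  using p_integral_add[OF _ p_integral_minus] by fastforce

lemma p_integral_0: "0 \<in> p_integral p" and p_integral_1: "1 \<in> p_integral p"
  using p_integral_of_nat[OF p, of 0] p_integral_of_nat[OF p, of 1] by auto

lemma p_integral_sum: "(\<And>i. i \<in> A \<Longrightarrow> f i \<in> p_integral p) \<Longrightarrow> sum f A \<in> p_integral p"
  by (induction A rule: infinite_finite_induct) (auto simp: p_integral_0 p_integral_add)

lemma p_integral_power: "x \<in> p_integral p \<Longrightarrow> x ^ k \<in> p_integral p"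
  by (induction k) (auto simp: p_integral_1 p_integral_mult)

lemma p_integral_inverse:
  assumes "\<not> p dvd k"
  shows "1 / of_nat k \<in> p_integral p"
proof -
  have "1 / of_nat k = of_int 1 / (of_int (int k) :: rat)" "\<not> int p dvd int k"
    using assms by simp_all
  then show ?thesis unfolding p_integral_def by blast
qed

lemma rat_congI:
  "x \<in> p_integral p \<Longrightarrow> y \<in> p_integral p \<Longrightarrow> z \<in> p_integral p \<Longrightarrow> x - y = of_nat p * z \<Longrightarrow> rat_cong p x y"
  unfolding rat_cong_def by blast

lemma rat_cong_refl: "x \<in> p_integral p \<Longrightarrow> rat_cong p x x"
  by (rule rat_congI[of _ _ 0]) (auto simp: p_integral_0)

lemma rat_cong_sym: "rat_cong p x y \<Longrightarrow> rat_cong p y x"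
  unfolding rat_cong_def by (metis minus_diff_eq mult_minus_right p_integral_minus)

lemma rat_cong_add:
  assumes "rat_cong p x y" "rat_cong p x' y'"
  shows "rat_cong p (x + x') (y + y')"
proof -
  from assms obtain z z' where "z \<in> p_integral p" "z' \<in> p_integral p"
    "x - y = of_nat p * z" "x' - y' = of_nat p * z'" unfolding rat_cong_def by blast
  moreover from this have "x + x' - (y + y') = of_nat p * (z + z')" by (simp add: algebra_simps)
  ultimately show ?thesis
    using assms unfolding rat_cong_def by (blast intro: p_integral_add)
qed

lemma rat_cong_trans [trans]:
  assumes "rat_cong p x y" "rat_cong p y z"
  shows "rat_cong p x z"
proof -
  from assms obtain u v where "u \<in> p_integral p" "v \<in> p_integral p"
    "x - y = of_nat p * u" "y - z = of_nat p * v" unfolding rat_cong_def by blast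
  moreover from this have "x - z = of_nat p * (u + v)" by (simp add: algebra_simps)
  ultimately show ?thesis
    using assms unfolding rat_cong_def by (blast intro: p_integral_add)
qed

lemma rat_cong_mult:
  assumes "rat_cong p x y" "rat_cong p x' y'"
  shows "rat_cong p (x * x') (y * y')"
proof -
  from assms obtain z z' where z: "z \<in> p_integral p" "z' \<in> p_integral p"
    "x - y = of_nat p * z" "x' - y' = of_nat p * z'" unfolding rat_cong_def by blast
  have "x * x' - y * y' = (x - y) * x' + y * (x' - y')" by (simp add: algebra_simps)
  also have "\<dots> = of_nat p * (z * x' + y * z')" unfolding z by (simp add: algebra_simps)
  finally show ?thesis
    using assms z by (intro rat_congI[of _ _ "z * x' + y * z'"])
      (auto simp: rat_cong_def intro!: p_integral_add p_integral_mult)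
qed

lemma rat_cong_minus: "rat_cong p x y \<Longrightarrow> rat_cong p (- x) (- y)"
  using rat_cong_mult[OF rat_cong_refl[OF p_integral_of_int[OF p, of "-1"]]] by simp

lemma rat_cong_diff: "rat_cong p x y \<Longrightarrow> rat_cong p x' y' \<Longrightarrow> rat_cong p (x - x') (y - y')"
  using rat_cong_add[OF _ rat_cong_minus] by fastforce

lemma rat_cong_mult_left: "c \<in> p_integral p \<Longrightarrow> rat_cong p x y \<Longrightarrow> rat_cong p (c * x) (c * y)"
  by (rule rat_cong_mult[OF rat_cong_refl])

lemma rat_cong_sum: "(\<And>i. i \<in> A \<Longrightarrow> rat_cong p (f i) (g i)) \<Longrightarrow> rat_cong p (sum f A) (sum g A)"
  by (induction A rule: infinite_finite_induct)
    (auto simp: p_integral_0 rat_cong_refl rat_cong_add)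

lemma rat_cong_prod: "(\<And>i. i \<in> A \<Longrightarrow> rat_cong p (f i) (g i)) \<Longrightarrow> rat_cong p (prod f A) (prod g A)"
  by (induction A rule: infinite_finite_induct)
    (auto simp: p_integral_1 rat_cong_refl rat_cong_mult)

lemma rat_cong_power: "rat_cong p x y \<Longrightarrow> rat_cong p (x ^ k) (y ^ k)"
  by (induction k) (auto simp: p_integral_1 rat_cong_refl rat_cong_mult)

lemma rat_cong_cancel:
  assumes "rat_cong p (of_nat k * x) (of_nat k * y)" "\<not> p dvd k"
  shows "rat_cong p x y"
proof -
  have "k \<noteq> 0" using assms(2) by (metis dvd_0_right)
  then show ?thesis
    using rat_cong_mult_left[OF p_integral_inverse[OF assms(2)] assms(1)] by simp
qed

section \<open>Inverses, Bernoulli numbers and power sums modulo \<open>p\<close>\<close>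

lemma not_dvd_less: "0 < k \<Longrightarrow> k < p \<Longrightarrow> \<not> p dvd k"
  by (auto dest: dvd_imp_le)

lemma rat_cong_fermat:
  assumes "0 < k" "k < p"
  shows "rat_cong p (of_nat k ^ (p - 1)) 1"
proof -
  have "[k ^ (p - 1) = 1] (mod p)"
    using fermat_theorem[OF p not_dvd_less[OF assms]] .
  then have "int p dvd int k ^ (p - 1) - 1"
    by (metis cong_iff_dvd_diff cong_int_iff of_nat_1 of_nat_power)
  then obtain m where "int k ^ (p - 1) - 1 = int p * m" by blast
  then have "(of_nat k :: rat) ^ (p - 1) - 1 = of_nat p * of_int m"
    by (metis of_int_1 of_int_diff of_int_mult of_int_of_nat_eq of_int_power)
  then show ?thesis
    by (intro rat_congI[of _ _ "of_int m"])
      (auto intro!: p_integral_power p_integral_of_nat p_integral_of_int p p_integral_1)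
qed

lemma inverse_power_p_integral: "0 < k \<Longrightarrow> k < p \<Longrightarrow> (1 / of_nat k) ^ s \<in> p_integral p"
  by (intro p_integral_power p_integral_inverse not_dvd_less)

text \<open>Fermat's theorem trades negative exponents for nonnegative ones, which makes harmonic
  sums accessible to Faulhaber's formula.\<close>

lemma rat_cong_inverse_power:
  assumes "0 < k" "k < p" "s \<le> p - 1"
  shows "rat_cong p ((1 / of_nat k) ^ s) (of_nat k ^ (p - 1 - s))"
proof -
  have "rat_cong p ((1 / of_nat k) ^ s * 1) ((1 / of_nat k) ^ s * of_nat k ^ (p - 1))"
    by (intro rat_cong_mult_left rat_cong_sym[OF rat_cong_fermat] inverse_power_p_integral assms)
  moreover have "(1 / of_nat k) ^ s * (of_nat k :: rat) ^ (p - 1) = of_nat k ^ (p - 1 - s)"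
    using assms by (simp add: power_diff power_one_over)
  ultimately show ?thesis by simp
qed

lemma rat_cong_inverse_reflect:
  assumes "0 < k" "k < p"
  shows "rat_cong p ((1 / of_nat (p - k)) ^ s) ((-1) ^ s * (1 / of_nat k) ^ s)"
proof -
  have "rat_cong p (1 / of_nat (p - k)) (- (1 / of_nat k))"
  proof (rule rat_congI)
    show "(1 / of_nat (p - k)) - (- (1 / of_nat k)) = (of_nat p :: rat) * (1 / of_nat (p - k) * (1 / of_nat k))"
      using assms by (simp add: field_simps of_nat_diff)
  qed (use assms in \<open>(intro p_integral_mult p_integral_minus p_integral_inverse not_dvd_less; simp)+\<close>)
  from rat_cong_power[OF this, of s] show ?thesis
    by (metis power_minus)
qed

text \<open>The recursion for B_k divides only by k + 1, which is below \<open>p\<close>.\<close>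

lemma bernoulli_p_integral: "k + 1 < p \<Longrightarrow> bernoulli k \<in> p_integral p"
proof (induction k rule: less_induct)
  case (less k)
  show ?case
  proof (cases k)
    case 0
    then show ?thesis by (simp add: bernoulli.simps p_integral_1)
  next
    case (Suc m)
    have "bernoulli k = - (\<Sum>i\<le>m. of_nat (m + 2 choose i) * bernoulli i) * (1 / of_nat (m + 2))"
      by (simp add: Suc bernoulli.simps)
    also have "\<dots> \<in> p_integral p"
      using less Suc by (intro p_integral_mult p_integral_minus p_integral_sum p_integral_inverse
        not_dvd_less p_integral_of_nat p) auto
    finally show ?thesis .
  qed
qed

text \<open>Every term of Faulhaber's formula at j = p contains a positive power of
  \<open>p\<close>, with \<open>p\<close>-integral Bernoulli numbers as coefficients; the factor r +
  1 is invertible modulo \<open>p\<close>.\<close>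

lemma rat_cong_power_sum_zero:
  assumes "0 < r" "r + 1 < p"
  shows "rat_cong p (\<Sum>i\<in>{1..<p}. of_nat i ^ r) 0"
proof (rule rat_cong_cancel[of "Suc r"])
  have "{..<p} = insert 0 {1..<p}" using p prime_gt_0_nat by auto
  then have eq: "(\<Sum>i\<in>{1..<p}. of_nat i ^ r) = (\<Sum>i<p. (of_nat i :: rat) ^ r)"
    using assms by simp
  have "of_nat (Suc r) * (\<Sum>i<p. of_nat i ^ r) - of_nat (Suc r) * 0 =
      of_nat p * (\<Sum>k\<le>r. of_nat (Suc r choose k) * bernoulli k * of_nat p ^ (r - k))"
    unfolding bernoulli_power_sum
    by (simp add: sum_distrib_left Suc_diff_le algebra_simps)
  then show "rat_cong p (of_nat (Suc r) * (\<Sum>i\<in>{1..<p}. of_nat i ^ r)) (of_nat (Suc r) * 0)"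
    unfolding eq
    by (rule rat_congI[rotated 3])
      (use assms in \<open>auto intro!: p_integral_mult p_integral_sum p_integral_power p_integral_0
        p_integral_of_nat p bernoulli_p_integral simp del: of_nat_Suc\<close>)
  show "\<not> p dvd Suc r" using assms by (intro not_dvd_less) auto
qed

text \<open>Below 2(p - 1), one application of Fermat's theorem brings any exponent above p - 1 back
  to the range of \<open>rat_cong_power_sum_zero\<close>.\<close>

lemma rat_cong_power_sum:
  assumes "0 < r" "r < 2 * (p - 1)"
  shows "rat_cong p (\<Sum>i\<in>{1..<p}. of_nat i ^ r) (if r = p - 1 then -1 else 0)"
proof -
  consider "r < p - 1" | "r = p - 1" | "r > p - 1" by linarith
  then show ?thesis
  proof cases
    case 1
    then show ?thesis using rat_cong_power_sum_zero[of r] assms by simp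
  next
    case 2
    have "rat_cong p (\<Sum>i\<in>{1..<p}. of_nat i ^ r) (\<Sum>i\<in>{1..<p}. 1)"
      unfolding 2 by (intro rat_cong_sum rat_cong_fermat) auto
    also have "rat_cong p (\<Sum>i\<in>{1..<p}. 1) (-1)"
      using prime_gt_0_nat[OF p]
      by (intro rat_congI[of _ _ 1])
        (auto intro!: p_integral_minus p_integral_1 p_integral_sum p_integral_diff p_integral_of_nat p)
    finally show ?thesis using 2 by simp
  next
    case 3
    have "rat_cong p (\<Sum>i\<in>{1..<p}. of_nat i ^ (p - 1) * of_nat i ^ (r - (p - 1)))
        (\<Sum>i\<in>{1..<p}. 1 * of_nat i ^ (r - (p - 1)))"
      by (intro rat_cong_sum rat_cong_mult rat_cong_fermat rat_cong_refl p_integral_power p_integral_of_nat p) auto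
    also have "rat_cong p (\<Sum>i\<in>{1..<p}. 1 * of_nat i ^ (r - (p - 1))) 0"
      using rat_cong_power_sum_zero[of "r - (p - 1)"] 3 assms by simp
    finally show ?thesis using 3 by (simp flip: power_add)
  qed
qed

text \<open>Multiplied by k!, the binomial is an integer polynomial in its upper argument, and k! is
  invertible modulo \<open>p\<close> for k < p.\<close>

lemma rat_cong_gbinomial:
  assumes "rat_cong p x y" "k < p"
  shows "rat_cong p (x gchoose k) (y gchoose k)"
proof (rule rat_cong_cancel[of "fact k"])
  have "rat_cong p (\<Prod>i<k. x - of_nat i) (\<Prod>i<k. y - of_nat i)"
    by (intro rat_cong_prod rat_cong_diff rat_cong_refl assms p_integral_of_nat p)
  then show "rat_cong p (of_nat (fact k) * (x gchoose k)) (of_nat (fact k) * (y gchoose k))"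
    by (simp add: gbinomial_prod_rev atLeast0LessThan)
  show "\<not> p dvd fact k" using assms p by (simp add: prime_dvd_fact_iff)
qed

section \<open>Multiple harmonic sums modulo \<open>p\<close>\<close>

definition harm1 :: "nat \<Rightarrow> rat" where
  "harm1 s = (\<Sum>i\<in>{1..<p}. (1 / of_nat i) ^ s)"

definition harm2 :: "nat \<Rightarrow> nat \<Rightarrow> rat" where
  "harm2 s t = (\<Sum>j\<in>{1..<p}. \<Sum>i\<in>{1..<j}. (1 / of_nat i) ^ s * (1 / of_nat j) ^ t)"

text \<open>A set of triples instead of nested sums, so that reversal and passage to partial sums
  become bijections.\<close>

definition increasing_triples :: "(nat \<times> nat \<times> nat) set" where
  "increasing_triples = {(i, j, k). 0 < i \<and> i < j \<and> j < k \<and> k < p}"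

definition harm3 :: "nat \<Rightarrow> nat \<Rightarrow> nat \<Rightarrow> rat" where
  "harm3 s t u = (\<Sum>(i, j, k)\<in>increasing_triples. (1 / of_nat i) ^ s * (1 / of_nat j) ^ t * (1 / of_nat k) ^ u)"

lemma harm1_cong_zero:
  assumes "0 < s" "s + 1 < p"
  shows "rat_cong p (harm1 s) 0"
proof -
  have "rat_cong p (harm1 s) (\<Sum>i\<in>{1..<p}. of_nat i ^ (p - 1 - s))"
    unfolding harm1_def using assms by (intro rat_cong_sum rat_cong_inverse_power) auto
  also have "rat_cong p \<dots> 0"
    using assms by (intro rat_cong_power_sum_zero) auto
  finally show ?thesis .
qed

lemma harm2_p_integral: "harm2 s t \<in> p_integral p"
  unfolding harm2_def by (intro p_integral_sum p_integral_mult inverse_power_p_integral) auto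

lemma harm3_p_integral: "harm3 s t u \<in> p_integral p"
  unfolding harm3_def
  by (intro p_integral_sum) (auto simp: increasing_triples_def intro!: p_integral_mult inverse_power_p_integral)

text \<open>Fermat's theorem makes both exponents nonnegative and Faulhaber's formula evaluates the
  inner sum as a polynomial in \<open>j\<close>. Summing over \<open>j\<close> kills every power
  except j^(p-1), which picks out the Bernoulli number of index p - (a + b).\<close>

lemma harm2_cong:
  assumes "0 < a" "0 < b" "a + b + 1 < p"
  shows "rat_cong p (harm2 a b)
    ((-1) ^ b / of_nat (a + b) * of_nat (a + b choose a) * bernoulli (p - (a + b)))"
proof -
  define r where "r = p - 1 - a"
  \<comment> \<open>The coefficient of j^(r+1-k) in the inner power sum; it is
    \<open>p\<close>-integral because r + 1 = p - a is prime to \<open>p\<close>.\<close>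
  define c where "c k = 1 / of_nat (Suc r) * (of_nat (Suc r choose k) * bernoulli k)" for k
  have r: "Suc r = p - a" "0 < r" "r + 1 < p" using assms by (auto simp: r_def)
  have c: "c k \<in> p_integral p" if "k \<le> r" for k
    unfolding c_def using that r
    by (intro p_integral_mult p_integral_inverse not_dvd_less p_integral_of_nat p bernoulli_p_integral) auto
  have "harm2 a b = (\<Sum>j\<in>{1..<p}. (1 / of_nat j) ^ b * (\<Sum>i\<in>{1..<j}. (1 / of_nat i) ^ a))"
    unfolding harm2_def by (simp add: sum_distrib_left mult.commute)
  also have "rat_cong p \<dots> (\<Sum>j\<in>{1..<p}. of_nat j ^ (p - 1 - b) * (\<Sum>i\<in>{1..<j}. of_nat i ^ r))"
    unfolding r_def using assms
    by (intro rat_cong_sum rat_cong_mult rat_cong_inverse_power) auto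
  also have "(\<Sum>j\<in>{1..<p}. of_nat j ^ (p - 1 - b) * (\<Sum>i\<in>{1..<j}. of_nat i ^ r))
      = (\<Sum>j\<in>{1..<p}. \<Sum>k\<le>r. c k * of_nat j ^ (2 * p - 1 - a - b - k))"
  proof (intro sum.cong refl)
    fix j assume j: "j \<in> {1..<p}"
    have "{..<j} = insert 0 {1..<j}" using j by auto
    then have "(\<Sum>i\<in>{1..<j}. of_nat i ^ r) = (\<Sum>i<j. (of_nat i :: rat) ^ r)"
      using r by simp
    also have "\<dots> = 1 / of_nat (Suc r) * (of_nat (Suc r) * (\<Sum>i<j. (of_nat i :: rat) ^ r))"
      by simp
    also have "\<dots> = (\<Sum>k\<le>r. c k * of_nat j ^ (Suc r - k))"
      unfolding bernoulli_power_sum unfolding c_def sum_distrib_left by (intro sum.cong refl) (simp only: mult.assoc)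
    finally have eq: "(\<Sum>i\<in>{1..<j}. of_nat i ^ r) = (\<Sum>k\<le>r. c k * of_nat j ^ (Suc r - k))" .
    have "of_nat j ^ (p - 1 - b) * (c k * of_nat j ^ (Suc r - k)) = c k * of_nat j ^ (2 * p - 1 - a - b - k)"
      if "k \<le> r" for k
    proof -
      have "2 * p - 1 - a - b - k = (p - 1 - b) + (Suc r - k)"
        using that r assms by linarith
      then show ?thesis by (simp only: power_add) (simp only: mult_ac)
    qed
    then show "of_nat j ^ (p - 1 - b) * (\<Sum>i\<in>{1..<j}. of_nat i ^ r) =
        (\<Sum>k\<le>r. c k * of_nat j ^ (2 * p - 1 - a - b - k))"
      unfolding eq sum_distrib_left by (intro sum.cong refl) auto
  qed
  also have "\<dots> = (\<Sum>k\<le>r. c k * (\<Sum>j\<in>{1..<p}. of_nat j ^ (2 * p - 1 - a - b - k)))"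
    by (subst sum.swap) (simp add: sum_distrib_left)
  \<comment> \<open>The exponents lie strictly between 0 and 2(p - 1), so p - 1 is the only one with
    a nonzero power sum.\<close>
  also have "rat_cong p \<dots> (\<Sum>k\<le>r. c k * (if 2 * p - 1 - a - b - k = p - 1 then -1 else 0))"
    using r assms by (intro rat_cong_sum rat_cong_mult_left c rat_cong_power_sum) auto
  also have "(\<Sum>k\<le>r. c k * (if 2 * p - 1 - a - b - k = p - 1 then -1 else 0))
      = (\<Sum>k\<le>r. if k = p - (a + b) then - c k else 0)"
    using r assms by (intro sum.cong refl) auto
  also have "\<dots> = - c (p - (a + b))"
    using r assms by simp
  \<comment> \<open>The generalised binomial allows the upper argument p - a to be replaced by -a;
    the exponent 1 fits \<open>rat_cong_inverse_reflect\<close>.\<close>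
  also have "\<dots> = - ((1 / of_nat (p - a)) ^ 1) * ((of_nat (p - a) :: rat) gchoose b) * bernoulli (p - (a + b))"
  proof -
    have "Suc r choose (p - (a + b)) = (p - a choose b)"
      using binomial_symmetric[of b "p - a"] assms r by (simp add: diff_diff_add)
    then show ?thesis unfolding c_def r by (simp add: binomial_gbinomial)
  qed
  also have "rat_cong p \<dots>
      (- ((-1) ^ 1 * (1 / of_nat a) ^ 1) * ((- of_nat a) gchoose b) * bernoulli (p - (a + b)))"
  proof (intro rat_cong_mult rat_cong_minus rat_cong_inverse_reflect rat_cong_gbinomial)
    show "rat_cong p (of_nat (p - a)) (- of_nat a)"
      using assms by (intro rat_congI[of _ _ 1])
        (auto simp: of_nat_diff intro!: p_integral_1 p_integral_minus p_integral_diff p_integral_of_nat p)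
    show "rat_cong p (bernoulli (p - (a + b))) (bernoulli (p - (a + b)))"
      using assms by (intro rat_cong_refl bernoulli_p_integral) auto
  qed (use assms in auto)
  \<comment> \<open>Upper negation turns the binomial into (-1)^b times a + b - 1 over b, and
    absorption moves the factor 1/a to 1/(a+b).\<close>
  also have "- ((-1) ^ 1 * (1 / of_nat a) ^ 1) * ((- of_nat a) gchoose b)
      = (-1) ^ b / of_nat (a + b) * (of_nat (a + b choose a) :: rat)"
  proof -
    obtain a' where a': "a = Suc a'" using assms gr0_conv_Suc by blast
    have "((- of_nat a) gchoose b) = (-1) ^ b * (of_nat (a' + b choose b) :: rat)"
      unfolding gbinomial_minus binomial_gbinomial by (simp add: a')
    moreover have "1 / of_nat a * of_nat (a' + b choose b) = 1 / of_nat (a + b) * (of_nat (a + b choose a) :: rat)"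
    proof -
      have "a * (a + b choose a) = (a + b) * (a' + b choose b)"
        using Suc_times_binomial[of a' "a' + b"] binomial_symmetric[of b "a' + b"] by (simp add: a')
      then have "of_nat a * of_nat (a + b choose a) = of_nat (a + b) * (of_nat (a' + b choose b) :: rat)"
        by (metis of_nat_mult)
      then show ?thesis using assms by (simp add: field_simps)
    qed
    ultimately show ?thesis by (simp flip: times_divide_eq_right)
  qed
  finally show ?thesis .
qed

section \<open>Triple harmonic sums: reversal and inclusion-exclusion\<close>

text \<open>The substitution i -> p - i reverses the order of the indices, and each reciprocal
  changes sign modulo \<open>p\<close>.\<close>

lemma harm3_reverse: "rat_cong p (harm3 z y x) ((-1) ^ (x + y + z) * harm3 x y z)"
proof -
  have "harm3 z y x = (\<Sum>(i, j, k)\<in>increasing_triples.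
      (1 / of_nat (p - i)) ^ x * (1 / of_nat (p - j)) ^ y * (1 / of_nat (p - k)) ^ z)"
    unfolding harm3_def
    by (rule sum.reindex_bij_witness[of _ "\<lambda>(i, j, k). (p - k, p - j, p - i)" "\<lambda>(i, j, k). (p - k, p - j, p - i)"])
      (auto simp: increasing_triples_def)
  also have "rat_cong p \<dots> (\<Sum>(i, j, k)\<in>increasing_triples. (-1) ^ (x + y + z) *
      ((1 / of_nat i) ^ x * (1 / of_nat j) ^ y * (1 / of_nat k) ^ z))"
  proof (rule rat_cong_sum, clarify)
    fix i j k assume "(i, j, k) \<in> increasing_triples"
    then have "rat_cong p ((1 / of_nat (p - i)) ^ x * (1 / of_nat (p - j)) ^ y * (1 / of_nat (p - k)) ^ z)
      (((-1) ^ x * (1 / of_nat i) ^ x) * ((-1) ^ y * (1 / of_nat j) ^ y) * ((-1) ^ z * (1 / of_nat k) ^ z))"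
      by (intro rat_cong_mult rat_cong_inverse_reflect) (auto simp: increasing_triples_def)
    moreover have "((-1) ^ x * (1 / of_nat i) ^ x) * ((-1) ^ y * (1 / of_nat j) ^ y) * ((-1) ^ z * (1 / of_nat k) ^ z)
      = (-1) ^ (x + y + z) * ((1 / of_nat i) ^ x * (1 / of_nat j) ^ y * (1 / (of_nat k :: rat)) ^ z)"
      by (simp only: power_add mult_ac)
    ultimately show "rat_cong p ((1 / of_nat (p - i)) ^ x * (1 / of_nat (p - j)) ^ y * (1 / of_nat (p - k)) ^ z)
      ((-1) ^ (x + y + z) * ((1 / of_nat i) ^ x * (1 / of_nat j) ^ y * (1 / of_nat k) ^ z))"
      by metis
  qed
  finally show ?thesis
    by (simp only: harm3_def sum_distrib_left case_prod_unfold)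
qed

text \<open>Order conditions move from the ranges into the summand, so that they can be negated and
  split as predicates over one fixed box.\<close>

lemma sum_pairs_if:
  fixes f :: "nat \<Rightarrow> nat \<Rightarrow> rat"
  shows "(\<Sum>j\<in>{1..<p}. \<Sum>i\<in>{1..<j}. f i j) = (\<Sum>i\<in>{1..<p}. \<Sum>j\<in>{1..<p}. if i < j then f i j else 0)"
proof -
  have "(\<Sum>i\<in>{1..<j}. f i j) = (\<Sum>i\<in>{1..<p}. if i < j then f i j else 0)" if "j < p" for j
    using that by (intro sum.mono_neutral_cong_left) auto
  then have "(\<Sum>j\<in>{1..<p}. \<Sum>i\<in>{1..<j}. f i j) = (\<Sum>j\<in>{1..<p}. \<Sum>i\<in>{1..<p}. if i < j then f i j else 0)"
    by simp
  also have "\<dots> = (\<Sum>i\<in>{1..<p}. \<Sum>j\<in>{1..<p}. if i < j then f i j else 0)"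
    by (rule sum.swap)
  finally show ?thesis .
qed

lemma sum_triples_if:
  fixes f :: "nat \<Rightarrow> nat \<Rightarrow> nat \<Rightarrow> rat"
  shows "(\<Sum>(i, j, k)\<in>increasing_triples. f i j k) =
    (\<Sum>i\<in>{1..<p}. \<Sum>j\<in>{1..<p}. \<Sum>k\<in>{1..<p}. if i < j \<and> j < k then f i j k else 0)"
proof -
  have "(\<Sum>i\<in>{1..<p}. \<Sum>j\<in>{1..<p}. \<Sum>k\<in>{1..<p}. if i < j \<and> j < k then f i j k else 0)
      = (\<Sum>(i, j, k)\<in>{1..<p} \<times> {1..<p} \<times> {1..<p}. if i < j \<and> j < k then f i j k else 0)"
    by (simp add: sum.cartesian_product)
  also have "\<dots> = (\<Sum>(i, j, k)\<in>increasing_triples. f i j k)"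
    by (intro sum.mono_neutral_cong_right) (auto simp: increasing_triples_def split: if_splits)
  finally show ?thesis by simp
qed

text \<open>Inclusion-exclusion, replacing each of the conditions \<open>i < j\<close> and \<open>j < k\<close> by its negation;
  the first two terms on the right vanish modulo \<open>p\<close> because they contain a factor \<open>harm1\<close>.\<close>

lemma harm3_antipode:
  "harm3 x y z = harm1 x * harm2 y z - (harm2 y x + harm1 (x + y)) * harm1 z
     + (harm3 z y x + harm2 z (x + y) + harm2 (y + z) x + harm1 (x + y + z))"
proof -
  define A where "A = {1..<p}"
  define u where "u s i = (1 / (of_nat i :: rat)) ^ s" for s i
  \<comment> \<open>All sums of the identity become values of \<open>g\<close> at order predicates;
    splitting a predicate into disjoint cases splits \<open>g\<close>.\<close>
  define g where "g P = (\<Sum>i\<in>A. \<Sum>j\<in>A. \<Sum>k\<in>A. if P i j k then u x i * u y j * u z k else 0)" for P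
  have fin: "finite A" by (simp add: A_def)
  have u_add: "u s i * u t i = u (s + t) i" for s t i by (simp add: u_def power_add)
  have g_add: "g P = g Q + g R" if "\<And>i j k. P i j k \<longleftrightarrow> Q i j k \<or> R i j k" "\<And>i j k. \<not> (Q i j k \<and> R i j k)" for P Q R
    unfolding g_def sum.distrib [symmetric] using that by (intro sum.cong refl) auto
  have h1: "harm1 s = (\<Sum>i\<in>A. u s i)" for s by (simp add: harm1_def A_def u_def)
  have h2: "harm2 s t = (\<Sum>i\<in>A. \<Sum>j\<in>A. if i < j then u s i * u t j else 0)" for s t
    unfolding harm2_def sum_pairs_if A_def u_def ..
  have h3: "harm3 x y z = g (\<lambda>i j k. i < j \<and> j < k)"
    unfolding harm3_def sum_triples_if g_def A_def u_def ..
  have h3': "harm3 z y x = g (\<lambda>i j k. k < j \<and> j < i)"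
  proof -
    have "harm3 z y x = (\<Sum>k\<in>A. \<Sum>j\<in>A. \<Sum>i\<in>A. if k < j \<and> j < i then u z k * u y j * u x i else 0)"
      unfolding harm3_def sum_triples_if A_def u_def ..
    also have "\<dots> = (\<Sum>j\<in>A. \<Sum>k\<in>A. \<Sum>i\<in>A. if k < j \<and> j < i then u z k * u y j * u x i else 0)"
      by (rule sum.swap)
    also have "\<dots> = (\<Sum>j\<in>A. \<Sum>i\<in>A. \<Sum>k\<in>A. if k < j \<and> j < i then u z k * u y j * u x i else 0)"
      by (intro sum.cong refl sum.swap)
    also have "\<dots> = (\<Sum>i\<in>A. \<Sum>j\<in>A. \<Sum>k\<in>A. if k < j \<and> j < i then u z k * u y j * u x i else 0)"
      by (rule sum.swap)
    also have "\<dots> = g (\<lambda>i j k. k < j \<and> j < i)"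
      unfolding g_def by (intro sum.cong refl) simp
    finally show ?thesis .
  qed
  have e1: "harm1 x * harm2 y z = g (\<lambda>i j k. j < k)"
    unfolding h1 h2 g_def by (simp only: sum_distrib_right) (auto simp: sum_distrib_left intro!: sum.cong)
  have e2: "harm2 y x * harm1 z = g (\<lambda>i j k. j < i)"
  proof -
    have "harm2 y x = (\<Sum>i\<in>A. \<Sum>j\<in>A. if j < i then u x i * u y j else 0)"
      unfolding h2 by (subst sum.swap) (auto intro!: sum.cong)
    then show ?thesis
      unfolding h1 g_def by (simp only: sum_distrib_right) (auto simp: sum_distrib_left intro!: sum.cong)
  qed
  have e3: "harm1 (x + y) * harm1 z = g (\<lambda>i j k. i = j)"
  proof -
    have "(\<Sum>j\<in>A. \<Sum>k\<in>A. if i = j then u x i * u y j * u z k else 0) = u (x + y) i * harm1 z" if "i \<in> A" for i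
    proof -
      have "(\<Sum>j\<in>A. \<Sum>k\<in>A. if i = j then u x i * u y j * u z k else 0)
          = (\<Sum>j\<in>A. if i = j then \<Sum>k\<in>A. u x i * u y j * u z k else 0)"
        by (intro sum.cong refl) auto
      then show ?thesis using that fin by (simp add: u_add h1 sum_distrib_left)
    qed
    then show ?thesis unfolding g_def by (simp add: h1 sum_distrib_right)
  qed
  have e4: "harm2 z (x + y) = g (\<lambda>i j k. k < j \<and> j = i)"
  proof -
    have "(\<Sum>j\<in>A. \<Sum>k\<in>A. if k < j \<and> j = i then u x i * u y j * u z k else 0)
        = (\<Sum>k\<in>A. if k < i then u z k * u (x + y) i else 0)" if "i \<in> A" for i
    proof -
      have "(\<Sum>j\<in>A. \<Sum>k\<in>A. if k < j \<and> j = i then u x i * u y j * u z k else 0)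
          = (\<Sum>j\<in>A. if j = i then \<Sum>k\<in>A. if k < i then u z k * u (x + y) i else 0 else 0)"
        by (intro sum.cong refl) (auto simp flip: u_add intro!: sum.cong)
      then show ?thesis using that fin by simp
    qed
    then show ?thesis unfolding g_def h2 by (subst sum.swap) simp
  qed
  have e5: "harm2 (y + z) x = g (\<lambda>i j k. k = j \<and> j < i)"
  proof -
    have "(\<Sum>k\<in>A. if k = j \<and> j < i then u x i * u y j * u z k else 0)
        = (if j < i then u (y + z) j * u x i else 0)" if "j \<in> A" for i j
    proof -
      have "(\<Sum>k\<in>A. if k = j \<and> j < i then u x i * u y j * u z k else 0)
        = (\<Sum>k\<in>A. if k = j then if j < i then u y j * u z j * u x i else 0 else 0)"
        by (intro sum.cong refl) auto
      then show ?thesis using that fin by (simp add: u_add)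
    qed
    then show ?thesis unfolding g_def h2 by (subst sum.swap) simp
  qed
  have e6: "harm1 (x + y + z) = g (\<lambda>i j k. k = j \<and> j = i)"
  proof -
    have "(\<Sum>j\<in>A. \<Sum>k\<in>A. if k = j \<and> j = i then u x i * u y j * u z k else 0)
        = u (x + y + z) i" if "i \<in> A" for i
    proof -
      have "(\<Sum>k\<in>A. if k = j \<and> j = i then u x i * u y j * u z k else 0)
        = (\<Sum>k\<in>A. if k = j then if j = i then u x i * u y i * u z i else 0 else 0)" for j
        by (intro sum.cong refl) auto
      then show ?thesis using that fin by (simp add: u_add)
    qed
    then show ?thesis unfolding g_def h1 by simp
  qed
  \<comment> \<open>Negating i < j, then j < k, leaves j \<le> i and k \<le> j; resolving both weak
    inequalities gives the four terms in the last bracket.\<close>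
  have "g (\<lambda>i j k. j < k) = g (\<lambda>i j k. i < j \<and> j < k) + g (\<lambda>i j k. j \<le> i \<and> j < k)"
    by (rule g_add) auto
  moreover have "g (\<lambda>i j k. j \<le> i) = g (\<lambda>i j k. j \<le> i \<and> j < k) + g (\<lambda>i j k. j \<le> i \<and> k \<le> j)"
    by (rule g_add) auto
  moreover have "g (\<lambda>i j k. j \<le> i) = g (\<lambda>i j k. j < i) + g (\<lambda>i j k. i = j)"
    by (rule g_add) auto
  moreover have "g (\<lambda>i j k. j \<le> i \<and> k \<le> j) = g (\<lambda>i j k. k < j \<and> j \<le> i) + g (\<lambda>i j k. k = j \<and> j \<le> i)"
    by (rule g_add) auto
  moreover have "g (\<lambda>i j k. k < j \<and> j \<le> i) = g (\<lambda>i j k. k < j \<and> j < i) + g (\<lambda>i j k. k < j \<and> j = i)"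
    by (rule g_add) auto
  moreover have "g (\<lambda>i j k. k = j \<and> j \<le> i) = g (\<lambda>i j k. k = j \<and> j < i) + g (\<lambda>i j k. k = j \<and> j = i)"
    by (rule g_add) auto
  ultimately show ?thesis
    unfolding distrib_right e1 e2 e3 e4 e5 e6 h3 h3' by linarith
qed

text \<open>In \<open>harm3_antipode\<close> the terms with \<open>harm1\<close> vanish modulo
  \<open>p\<close>, and for odd weight the reversed sum is congruent to -\<open>harm3 x y z\<close>.
  Twice the triple sum is thus a combination of two double sums of the same weight.\<close>

lemma harm3_cong:
  assumes "0 < x" "0 < y" "0 < z" "odd (x + y + z)" "x + y + z + 1 < p"
  shows "rat_cong p (harm3 x y z) (h_coeff x y z * bernoulli (p - (x + y + z)))"
proof -
  define m where "m = x + y + z"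
  define B where "B = bernoulli (p - m)"
  have "rat_cong p (harm3 x y z) (0 * harm2 y z - (harm2 y x + 0) * 0
     + ((-1) ^ m * harm3 x y z
        + (-1) ^ (x + y) / of_nat (z + (x + y)) * of_nat (z + (x + y) choose z) * bernoulli (p - (z + (x + y)))
        + (-1) ^ x / of_nat (y + z + x) * of_nat (y + z + x choose (y + z)) * bernoulli (p - (y + z + x)) + 0))"
    unfolding m_def using assms by (subst harm3_antipode)
      (intro rat_cong_add rat_cong_diff rat_cong_mult harm1_cong_zero rat_cong_refl harm2_p_integral
         harm3_reverse harm2_cong; simp)
  also have "(0 * harm2 y z - (harm2 y x + 0) * 0
     + ((-1) ^ m * harm3 x y z
        + (-1) ^ (x + y) / of_nat (z + (x + y)) * of_nat (z + (x + y) choose z) * bernoulli (p - (z + (x + y)))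
        + (-1) ^ x / of_nat (y + z + x) * of_nat (y + z + x choose (y + z)) * bernoulli (p - (y + z + x)) + 0))
     = 2 * (h_coeff x y z * B) - harm3 x y z"
  proof -
    have m: "z + (x + y) = m" "y + z + x = m" "x + y + z = m" by (simp_all add: m_def)
    have "(-1 :: rat) ^ m = -1" using assms by (simp add: m_def)
    \<comment> \<open>Odd weight turns the sign of \<open>harm2 z (x + y)\<close> into the second
      sign of \<open>h_coeff\<close>.\<close>
    moreover from this have "(-1 :: rat) ^ (x + y) = - ((-1) ^ z)"
      by (cases "even z") (use assms in \<open>auto\<close>)
    moreover have "m choose (y + z) = (m choose x)"
      using binomial_symmetric[of x m] by (simp add: m_def)
    moreover have "m > 0" using assms by (simp add: m_def)
    ultimately show ?thesis
      unfolding h_coeff_def Let_def m B_def by (simp add: field_simps)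
  qed
  finally have *: "rat_cong p (harm3 x y z) (2 * (h_coeff x y z * B) - harm3 x y z)" .
  have "rat_cong p (of_nat 2 * harm3 x y z) (of_nat 2 * (h_coeff x y z * B))"
    using rat_cong_add[OF * rat_cong_refl[OF harm3_p_integral[of x y z]]] by simp
  then show ?thesis
    unfolding B_def m_def using assms by (elim rat_cong_cancel) (intro not_dvd_less; simp)
qed

section \<open>From compositions of \<open>p\<close> to multiple harmonic sums\<close>

text \<open>The first three parts of a composition of \<open>p\<close> into four positive parts; the
  fourth is p - (x + y + z).\<close>

definition small_triples :: "(nat \<times> nat \<times> nat) set" where
  "small_triples = {(x, y, z). 0 < x \<and> 0 < y \<and> 0 < z \<and> x + y + z < p}"

definition tsum :: "nat \<Rightarrow> nat \<Rightarrow> nat \<Rightarrow> rat" where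
  "tsum a b c = (\<Sum>(x, y, z)\<in>small_triples.
     (1 / of_nat x) ^ a * (1 / of_nat y) ^ b * (1 / of_nat (x + y + z)) ^ c)"

text \<open>The two-variable expansion with \<open>V\<close> = 1/(x+y) leaves one variable, x + y
  and the total. The partial sums (x, x+y, x+y+z) run exactly through the increasing
  triples.\<close>

lemma tsum_eq_harm3:
  assumes "0 < a" "0 < b"
  shows "tsum a b c = (\<Sum>i<a. of_nat (i + b - 1 choose i) * harm3 (a - i) (b + i) c)
    + (\<Sum>i<b. of_nat (i + a - 1 choose i) * harm3 (b - i) (a + i) c)"
proof -
  have pf: "(\<Sum>(x, y, z)\<in>small_triples.
        pf2 (1 / of_nat (x + y)) (1 / of_nat x) a b * (1 / of_nat (x + y + z)) ^ c)
      = (\<Sum>i<a. of_nat (i + b - 1 choose i) * harm3 (a - i) (b + i) c)" for a b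
  proof -
    have "(\<Sum>(x, y, z)\<in>small_triples.
        pf2 (1 / of_nat (x + y)) (1 / of_nat x) a b * (1 / of_nat (x + y + z)) ^ c)
      = (\<Sum>(i, j, k)\<in>increasing_triples. pf2 (1 / of_nat j) (1 / of_nat i) a b * (1 / (of_nat k :: rat)) ^ c)"
      by (rule sum.reindex_bij_witness[of _ "\<lambda>(i, j, k). (i, j - i, k - j)" "\<lambda>(x, y, z). (x, x + y, x + y + z)"])
        (auto simp: increasing_triples_def small_triples_def)
    also have "\<dots> = (\<Sum>i<a. of_nat (i + b - 1 choose i) * harm3 (a - i) (b + i) c)"
      unfolding pf2_def harm3_def sum_distrib_left sum_distrib_right
      by (subst sum.swap) (auto simp: case_prod_unfold sum_distrib_right mult.assoc intro!: sum.cong)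
    finally show ?thesis .
  qed
  have "tsum a b c = (\<Sum>(x, y, z)\<in>small_triples.
        pf2 (1 / of_nat (x + y)) (1 / of_nat x) a b * (1 / of_nat (x + y + z)) ^ c)
      + (\<Sum>(x, y, z)\<in>small_triples.
        pf2 (1 / of_nat (x + y)) (1 / of_nat y) b a * (1 / of_nat (x + y + z)) ^ c)"
    unfolding tsum_def sum.distrib [symmetric]
  proof (intro sum.cong refl, clarify)
    fix x y z assume "(x, y, z) \<in> small_triples"
    then have "1 / of_nat x * (1 / of_nat y) = 1 / of_nat (x + y) * (1 / of_nat x + 1 / (of_nat y :: rat))"
      by (auto simp: small_triples_def field_simps)
    from partial_fractions2[OF this, of a b] assms
    show "(1 / of_nat x) ^ a * (1 / of_nat y) ^ b * (1 / of_nat (x + y + z)) ^ c =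
      pf2 (1 / of_nat (x + y)) (1 / of_nat x) a b * (1 / of_nat (x + y + z)) ^ c +
      pf2 (1 / of_nat (x + y)) (1 / of_nat y) b a * (1 / (of_nat (x + y + z) :: rat)) ^ c"
      by (simp add: distrib_right)
  qed
  \<comment> \<open>Exchanging x and y brings the second half into the form treated by
    \<open>pf\<close>.\<close>
  also have "(\<Sum>(x, y, z)\<in>small_triples.
        pf2 (1 / of_nat (x + y)) (1 / of_nat y) b a * (1 / of_nat (x + y + z)) ^ c)
    = (\<Sum>(x, y, z)\<in>small_triples.
        pf2 (1 / of_nat (x + y)) (1 / of_nat x) b a * (1 / (of_nat (x + y + z) :: rat)) ^ c)"
    by (rule sum.reindex_bij_witness[of _ "\<lambda>(x, y, z). (y, x, z)" "\<lambda>(x, y, z). (y, x, z)"])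
      (auto simp: small_triples_def add.commute)
  finally show ?thesis unfolding pf .
qed

lemma tsum_cong:
  assumes "0 < a" "0 < b" "0 < c" "odd (a + b + c)" "a + b + c + 1 < p"
  shows "rat_cong p (tsum a b c) (t_coeff a b c * bernoulli (p - (a + b + c)))"
proof -
  \<comment> \<open>Stated for arbitrary \<open>a\<close> and \<open>b\<close> because it is applied
    to both orders. All triple sums have the same weight, so one Bernoulli number factors
    out.\<close>
  have *: "rat_cong p (\<Sum>i<a. of_nat (i + b - 1 choose i) * harm3 (a - i) (b + i) c)
      ((\<Sum>i=0..a-1. of_nat (i + b - 1 choose i) * h_coeff (a - i) (b + i) c) * bernoulli (p - (a + b + c)))"
    if ab: "0 < a" "0 < b" "odd (a + b + c)" "a + b + c + 1 < p" for a b
  proof -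
    have "{0..a-1} = {..<a}" using ab by auto
    moreover have "rat_cong p (\<Sum>i<a. of_nat (i + b - 1 choose i) * harm3 (a - i) (b + i) c)
      (\<Sum>i<a. of_nat (i + b - 1 choose i) * (h_coeff (a - i) (b + i) c * bernoulli (p - (a - i + (b + i) + c))))"
      using ab assms by (intro rat_cong_sum rat_cong_mult_left p_integral_of_nat p harm3_cong) auto
    moreover have "(\<Sum>i<a. of_nat (i + b - 1 choose i) * (h_coeff (a - i) (b + i) c * bernoulli (p - (a - i + (b + i) + c))))
      = (\<Sum>i<a. of_nat (i + b - 1 choose i) * h_coeff (a - i) (b + i) c) * bernoulli (p - (a + b + c))"
      unfolding sum_distrib_right by (intro sum.cong refl) auto
    ultimately show ?thesis by simp
  qed
  have "rat_cong p (tsum a b c)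
     ((\<Sum>i=0..a-1. of_nat (i + b - 1 choose i) * h_coeff (a - i) (b + i) c) * bernoulli (p - (a + b + c))
    + (\<Sum>i=0..b-1. of_nat (i + a - 1 choose i) * h_coeff (b - i) (a + i) c) * bernoulli (p - (b + a + c)))"
    unfolding tsum_eq_harm3[OF assms(1,2)] using assms
    by (intro rat_cong_add *) (auto simp: add.commute)
  then show ?thesis
    by (simp add: t_coeff_def distrib_right add.commute)
qed

text \<open>Each of four positive parts with sum \<open>p\<close> is below \<open>p\<close>, so it
  is prime to \<open>p\<close>, and the last part is determined by the others.\<close>

lemma Zp_4_eq:
  "Zp p [a, b, c, d] = (\<Sum>(x, y, z)\<in>small_triples.
     (1 / of_nat x) ^ a * (1 / of_nat y) ^ b * (1 / of_nat z) ^ c * (1 / of_nat (p - (x + y + z))) ^ d)"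
proof -
  have "Zp p [a, b, c, d] = (\<Sum>ks | length ks = 4 \<and> sum_list ks = p \<and> set ks \<subseteq> prime_to_p p.
      1 / (\<Prod>i<4. of_nat (ks ! i) ^ ([a, b, c, d] ! i)))"
    by (simp add: Zp_def eval_nat_numeral)
  also have "\<dots> = (\<Sum>(x, y, z)\<in>small_triples.
     (1 / of_nat x) ^ a * (1 / of_nat y) ^ b * (1 / of_nat z) ^ c * (1 / of_nat (p - (x + y + z))) ^ d)"
  proof (rule sum.reindex_bij_witness[of _ "\<lambda>(x, y, z). [x, y, z, p - (x + y + z)]" "\<lambda>ks. (ks ! 0, ks ! 1, ks ! 2)"])
    fix ks assume "ks \<in> {ks. length ks = 4 \<and> sum_list ks = p \<and> set ks \<subseteq> prime_to_p p}"
    then obtain k1 k2 k3 k4 where ks: "ks = [k1, k2, k3, k4]" "k1 + k2 + k3 + k4 = p"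
      "k1 > 0" "k2 > 0" "k3 > 0" "k4 > 0"
      by (auto simp: eval_nat_numeral length_Suc_conv prime_to_p_def)
    have k4: "p - (k1 + k2 + k3) = k4" using ks by simp
    show "(case (ks ! 0, ks ! 1, ks ! 2) of (x, y, z) \<Rightarrow> [x, y, z, p - (x + y + z)]) = ks"
      using ks k4 by simp
    show "(ks ! 0, ks ! 1, ks ! 2) \<in> small_triples"
      using ks by (simp add: small_triples_def)
    show "(case (ks ! 0, ks ! 1, ks ! 2) of (x, y, z) \<Rightarrow>
        (1 / of_nat x) ^ a * (1 / of_nat y) ^ b * (1 / of_nat z) ^ c * (1 / of_nat (p - (x + y + z))) ^ d)
      = 1 / (\<Prod>i<4. (of_nat (ks ! i) :: rat) ^ ([a, b, c, d] ! i))"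
      using ks k4 by (simp add: eval_nat_numeral power_one_over field_simps)
  next
    fix t assume "t \<in> small_triples"
    then show "(case t of (x, y, z) \<Rightarrow> [x, y, z, p - (x + y + z)])
        \<in> {ks. length ks = 4 \<and> sum_list ks = p \<and> set ks \<subseteq> prime_to_p p}"
      using not_dvd_less by (auto simp: small_triples_def prime_to_p_def simp del: nat_dvd_not_less dvd_diff_nat)
    show "((case t of (x, y, z) \<Rightarrow> [x, y, z, p - (x + y + z)]) ! 0,
       (case t of (x, y, z) \<Rightarrow> [x, y, z, p - (x + y + z)]) ! 1,
       (case t of (x, y, z) \<Rightarrow> [x, y, z, p - (x + y + z)]) ! 2) = t"
      by (cases t) simp
  qed
  finally show ?thesis .
qed

lemma sum_pf3_tsum:
  assumes "0 < c"
  shows "(\<Sum>(x, y, z)\<in>small_triples.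
      pf3 (1 / of_nat (x + y + z)) (1 / of_nat x) (1 / of_nat y) a b c * (1 / of_nat (x + y + z)) ^ l)
    = (\<Sum>i=1..a. \<Sum>j=1..b. multinomial3 (a + b + c - i - j - 1) (a - i) (b - j) (c - 1)
        * tsum i j (a + b + c + l - i - j))"
proof -
  have "(\<Sum>(x, y, z)\<in>small_triples.
      pf3 (1 / of_nat (x + y + z)) (1 / of_nat x) (1 / of_nat y) a b c * (1 / of_nat (x + y + z)) ^ l)
    = (\<Sum>i<a. \<Sum>j<b. of_nat (pf3_coeff i j c) * tsum (a - i) (b - j) (i + j + c + l))"
    unfolding pf3_def tsum_def sum_distrib_left sum_distrib_right case_prod_unfold
    by (subst sum.swap, intro sum.cong refl, subst sum.swap) (simp add: power_add mult_ac)
  also have "\<dots> = (\<Sum>i=1..a. \<Sum>j=1..b. multinomial3 (a + b + c - i - j - 1) (a - i) (b - j) (c - 1)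
        * tsum i j (a + b + c + l - i - j))"
  \<comment> \<open>After the substitution the indices are the surviving exponents themselves, as in
    the theorem.\<close>
  proof (rule sum.reindex_bij_witness[of _ "\<lambda>i. a - i" "\<lambda>i. a - i"])
    fix i assume i: "i \<in> {..<a}"
    show "(\<Sum>j=1..b. multinomial3 (a + b + c - (a - i) - j - 1) (a - (a - i)) (b - j) (c - 1)
        * tsum (a - i) j (a + b + c + l - (a - i) - j))
      = (\<Sum>j<b. of_nat (pf3_coeff i j c) * tsum (a - i) (b - j) (i + j + c + l))"
    proof (rule sum.reindex_bij_witness[of _ "\<lambda>j. b - j" "\<lambda>j. b - j"])
      fix j assume j: "j \<in> {1..b}"
      have "a + b + c - (a - i) - j - 1 = i + (b - j) + c - 1" "a - (a - i) = i"
        "a + b + c + l - (a - i) - j = i + (b - j) + c + l" "b - (b - j) = j"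
        using i j by auto
      then show "of_nat (pf3_coeff i (b - j) c) * tsum (a - i) (b - (b - j)) (i + (b - j) + c + l) =
          multinomial3 (a + b + c - (a - i) - j - 1) (a - (a - i)) (b - j) (c - 1)
            * tsum (a - i) j (a + b + c + l - (a - i) - j)"
        using multinomial3_eq_pf3_coeff[OF assms, of i "b - j"] by simp
    qed auto
  qed auto
  finally show ?thesis .
qed

text \<open>The coefficients are natural numbers, and every \<open>tsum\<close> involved has weight
  a + b + c + l, so a single Bernoulli number is common to all terms.\<close>

lemma multinomial3_tsum_cong:
  assumes "0 < c" "0 < l" "odd (a + b + c + l)" "a + b + c + l + 1 < p"
  shows "rat_cong p (\<Sum>i=1..a. \<Sum>j=1..b. multinomial3 (a + b + c - i - j - 1) (a - i) (b - j) (c - 1)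
        * tsum i j (a + b + c + l - i - j))
      ((\<Sum>i=1..a. \<Sum>j=1..b. multinomial3 (a + b + c - i - j - 1) (a - i) (b - j) (c - 1)
        * t_coeff i j (a + b + c + l - i - j)) * bernoulli (p - (a + b + c + l)))"
  unfolding sum_distrib_right
proof (intro rat_cong_sum)
  fix i j assume ij: "i \<in> {1..a}" "j \<in> {1..b}"
  have "a + b + c - i - j - 1 = (a - i) + (b - j) + c - 1" using ij by auto
  then have "multinomial3 (a + b + c - i - j - 1) (a - i) (b - j) (c - 1) \<in> p_integral p"
    using multinomial3_eq_pf3_coeff[OF assms(1), of "a - i" "b - j"] by (simp add: p_integral_of_nat p)
  moreover have "i + j + (a + b + c + l - i - j) = a + b + c + l" using ij by auto
  then have "rat_cong p (tsum i j (a + b + c + l - i - j))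
      (t_coeff i j (a + b + c + l - i - j) * bernoulli (p - (a + b + c + l)))"
    using tsum_cong[of i j "a + b + c + l - i - j"] ij assms by auto
  ultimately show "rat_cong p
      (multinomial3 (a + b + c - i - j - 1) (a - i) (b - j) (c - 1) * tsum i j (a + b + c + l - i - j))
      (multinomial3 (a + b + c - i - j - 1) (a - i) (b - j) (c - 1) * t_coeff i j (a + b + c + l - i - j)
        * bernoulli (p - (a + b + c + l)))"
    unfolding mult.assoc by (rule rat_cong_mult_left)
qed

text \<open>The only congruence is the replacement of the fourth part by -(x + y + z), which yields
  the sign (-1)^l; the expansion afterwards is an exact identity.\<close>

lemma Zp_4_cong:
  assumes "0 < a" "0 < b" "0 < c"
  shows "rat_cong p (Zp p [a, b, c, l]) ((-1) ^ l *
    ((\<Sum>i=1..a. \<Sum>j=1..b. multinomial3 (a + b + c - i - j - 1) (a - i) (b - j) (c - 1)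
        * tsum i j (a + b + c + l - i - j))
   + (\<Sum>i=1..a. \<Sum>j=1..c. multinomial3 (a + c + b - i - j - 1) (a - i) (c - j) (b - 1)
        * tsum i j (a + c + b + l - i - j))
   + (\<Sum>i=1..b. \<Sum>j=1..c. multinomial3 (b + c + a - i - j - 1) (b - i) (c - j) (a - 1)
        * tsum i j (b + c + a + l - i - j))))"
proof -
  define V where "V x y z = 1 / (of_nat (x + y + z) :: rat)" for x y z :: nat
  define F where "F x y z = pf3 (V x y z) (1 / of_nat x) (1 / of_nat y) a b c * V x y z ^ l" for x y z
  define G where "G x y z = pf3 (V x y z) (1 / of_nat x) (1 / of_nat y) a c b * V x y z ^ l" for x y z
  define H where "H x y z = pf3 (V x y z) (1 / of_nat x) (1 / of_nat y) b c a * V x y z ^ l" for x y z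
  have "rat_cong p (Zp p [a, b, c, l]) (\<Sum>(x, y, z)\<in>small_triples.
      (1 / of_nat x) ^ a * (1 / of_nat y) ^ b * (1 / of_nat z) ^ c * ((-1) ^ l * V x y z ^ l))"
    unfolding Zp_4_eq V_def
  proof (rule rat_cong_sum, clarify)
    fix x y z assume "(x, y, z) \<in> small_triples"
    then show "rat_cong p
        ((1 / of_nat x) ^ a * (1 / of_nat y) ^ b * (1 / of_nat z) ^ c * (1 / of_nat (p - (x + y + z))) ^ l)
        ((1 / of_nat x) ^ a * (1 / of_nat y) ^ b * (1 / of_nat z) ^ c * ((-1) ^ l * (1 / of_nat (x + y + z)) ^ l))"
      by (intro rat_cong_mult_left rat_cong_inverse_reflect p_integral_mult inverse_power_p_integral)
        (auto simp: small_triples_def)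
  qed
  also have "(\<Sum>(x, y, z)\<in>small_triples.
      (1 / of_nat x) ^ a * (1 / of_nat y) ^ b * (1 / of_nat z) ^ c * ((-1) ^ l * V x y z ^ l))
    = (-1) ^ l * (\<Sum>(x, y, z)\<in>small_triples. F x y z + G x z y + H y z x)"
    unfolding sum_distrib_left
  proof (intro sum.cong refl, clarify)
    fix x y z assume "(x, y, z) \<in> small_triples"
    then have xyz: "0 < x" "0 < y" "0 < z" by (auto simp: small_triples_def)
    have V: "V x z y = V x y z" "V y z x = V x y z" by (simp_all add: V_def add_ac)
    have "1 / of_nat x * (1 / of_nat y) * (1 / of_nat z) = V x y z *
        (1 / of_nat y * (1 / of_nat z) + 1 / of_nat x * (1 / of_nat z) + 1 / of_nat x * (1 / of_nat y))"
      using xyz unfolding V_def by (simp add: field_simps)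
    from partial_fractions3[OF this, of a b c] assms
    show "(1 / of_nat x) ^ a * (1 / of_nat y) ^ b * (1 / of_nat z) ^ c * ((-1) ^ l * V x y z ^ l)
        = (-1) ^ l * (F x y z + G x z y + H y z x)"
      unfolding F_def G_def H_def V by (simp add: algebra_simps)
  qed
  also have "(\<Sum>(x, y, z)\<in>small_triples. F x y z + G x z y + H y z x)
    = (\<Sum>(x, y, z)\<in>small_triples. F x y z) + (\<Sum>(x, y, z)\<in>small_triples. G x z y)
      + (\<Sum>(x, y, z)\<in>small_triples. H y z x)"
    by (simp add: case_prod_unfold sum.distrib)
  \<comment> \<open>\<open>small_triples\<close> and \<open>V\<close> are symmetric, so the
    eliminated variable can always be renamed to the third one.\<close>
  also have "(\<Sum>(x, y, z)\<in>small_triples. G x z y) = (\<Sum>(x, y, z)\<in>small_triples. G x y z)"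
    by (rule sum.reindex_bij_witness[of _ "\<lambda>(x, y, z). (x, z, y)" "\<lambda>(x, y, z). (x, z, y)"])
      (auto simp: small_triples_def)
  also have "(\<Sum>(x, y, z)\<in>small_triples. H y z x) = (\<Sum>(x, y, z)\<in>small_triples. H x y z)"
    by (rule sum.reindex_bij_witness[of _ "\<lambda>(x, y, z). (z, x, y)" "\<lambda>(x, y, z). (y, z, x)"])
      (auto simp: small_triples_def)
  finally show ?thesis
    unfolding F_def G_def H_def V_def sum_pf3_tsum[OF assms(1)] sum_pf3_tsum[OF assms(2)] sum_pf3_tsum[OF assms(3)] .
qed

end

theorem theorem3p3:
  fixes p \<alpha> \<beta> \<gamma> l w n :: nat
  assumes "prime p"
    and "\<alpha> > 0" and "\<beta> > 0" and "\<gamma> > 0" and "l > 0"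
    and "w = \<alpha> + \<beta> + \<gamma> + l" and "odd w" and "p > w + 2"
    and "n = \<alpha> + \<beta> + \<gamma>"
  shows "rat_cong p (Zp p [\<alpha>, \<beta>, \<gamma>, l])
    ((-1) ^ l *
      ((\<Sum>a=1..\<alpha>. \<Sum>b=1..\<beta>.
          multinomial3 (n - a - b - 1) (\<alpha> - a) (\<beta> - b) (\<gamma> - 1) * t_coeff a b (w - a - b))
     + (\<Sum>a=1..\<alpha>. \<Sum>c=1..\<gamma>.
          multinomial3 (n - a - c - 1) (\<alpha> - a) (\<gamma> - c) (\<beta> - 1) * t_coeff a c (w - a - c))
     + (\<Sum>b=1..\<beta>. \<Sum>c=1..\<gamma>.
          multinomial3 (n - b - c - 1) (\<beta> - b) (\<gamma> - c) (\<alpha> - 1) * t_coeff b c (w - b - c)))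
     * bernoulli (p - w))"
proof -
  note p = \<open>prime p\<close>
  \<comment> \<open>The three sums list the exponents in different orders; these equations identify
    their totals with \<open>n\<close> and \<open>w\<close>.\<close>
  have perm: "\<alpha> + \<gamma> + \<beta> = n" "\<beta> + \<gamma> + \<alpha> = n" "\<alpha> + \<beta> + \<gamma> = n" "n + l = w"
    using assms by auto
  have sign: "(-1) ^ l \<in> p_integral p"
    by (intro p_integral_power p_integral_minus p_integral_1 p)
  note cong = multinomial3_tsum_cong[OF p]
  have "rat_cong p (Zp p [\<alpha>, \<beta>, \<gamma>, l]) ((-1) ^ l *
      ((\<Sum>a=1..\<alpha>. \<Sum>b=1..\<beta>.
          multinomial3 (n - a - b - 1) (\<alpha> - a) (\<beta> - b) (\<gamma> - 1) * t_coeff a b (w - a - b)) * bernoulli (p - w)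
     + (\<Sum>a=1..\<alpha>. \<Sum>c=1..\<gamma>.
          multinomial3 (n - a - c - 1) (\<alpha> - a) (\<gamma> - c) (\<beta> - 1) * t_coeff a c (w - a - c)) * bernoulli (p - w)
     + (\<Sum>b=1..\<beta>. \<Sum>c=1..\<gamma>.
          multinomial3 (n - b - c - 1) (\<beta> - b) (\<gamma> - c) (\<alpha> - 1) * t_coeff b c (w - b - c)) * bernoulli (p - w)))"
    using rat_cong_trans[OF p Zp_4_cong[OF p assms(2-4)] rat_cong_mult_left[OF p sign
        rat_cong_add[OF p rat_cong_add[OF p cong[of \<gamma> l \<alpha> \<beta>] cong[of \<beta> l \<alpha> \<gamma>]] cong[of \<alpha> l \<beta> \<gamma>]]]]
    unfolding perm using assms(2-5,7,8) by simp
  then show ?thesis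
    by (simp only: distrib_right mult.assoc)
qed

end
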